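(* Let $b\geq 2$ and $e\geq 1$ be integers, and let $$d=\left\lceil \frac{g(e)+1}{1-\left(\frac{b-2}{b-1}\right)^{e}}+e+p_{e,b}\right\rceil.$$ Let $h\ge 0$ and $u\geq 1$ be integers. If $\sigma_{h,e,b}(u)\geq b^{d}$, then $$S_{e,b}(\sigma_{h+1,e,b}(u))=\sigma_{h,e,b}(u).$$
   Context: For integers $b\ge 2$ and $e\ge 1$, $S_{e,b}$ is the function on positive integers sending $x=\sum_{i=0}^{n-1}a_i b^i$ (with digits $0\le a_i\le b-1$) to $S_{e,b}(x)=\sum_{i=0}^{n-1}a_i^e$. $S_{e,b}^{h}$ denotes the $h$-fold iterate, with $S_{e,b}^0(x)=x$. For a positive integer $u$ (the attractor), a positive integer $x$ is a height $h$, $u$ attracted number if $h$ is the smallest nonnegative integer with $S_{e,b}^h(x)=u$. $\sigma_{h,e,b}(u)$ denotes the smallest height $h$, $u$ attracted number, i.e. the smallest positive integer $k$ with $S_{e,b}^h(k)=u$ and $S_{e,b}^m(k)\neq u$ for all $0\le m<h$. $g(e)$ denotes the smallest integer such that every nonnegative integer can be written as $x_1^e+x_2^e+\dots+x_{g(e)}^e$ with $x_1,\dots,x_{g(e)}$ nonnegative integers (Waring's problem). $p_{e,b}$ denotes the smallest integer such that $b^{p_{e,b}}>g(e)$. *)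

theory Defs
  imports Complex_Main
begin

text \<open>For \<open>b \<ge> 2\<close> and \<open>x > 0\<close> the set \<open>{i. b ^ i \<le> x}\<close> consists of exactly the positions
  of the base-\<open>b\<close> digits of \<open>x\<close>, without leading zeros.\<close>

definition digit_power_sum :: "nat \<Rightarrow> nat \<Rightarrow> nat \<Rightarrow> nat" where
  "digit_power_sum e b x = (\<Sum>i | b ^ i \<le> x. (x div b ^ i mod b) ^ e)"

definition attracted :: "nat \<Rightarrow> nat \<Rightarrow> nat \<Rightarrow> nat \<Rightarrow> nat \<Rightarrow> bool" where
  "attracted e b h u x \<longleftrightarrow> x > 0 \<and> (digit_power_sum e b ^^ h) x = u \<and>
     (\<forall>m<h. (digit_power_sum e b ^^ m) x \<noteq> u)"

definition smallest_attracted :: "nat \<Rightarrow> nat \<Rightarrow> nat \<Rightarrow> nat \<Rightarrow> nat" where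
  "smallest_attracted h e b u = (LEAST k. attracted e b h u k)"

definition sums_of_powers_suffice :: "nat \<Rightarrow> nat \<Rightarrow> bool" where
  "sums_of_powers_suffice e s \<longleftrightarrow> (\<forall>n::nat. \<exists>x::nat \<Rightarrow> nat. n = (\<Sum>i<s. x i ^ e))"

text \<open>\<open>is_waring_number e g\<close> says that \<open>g\<close> is the number \<open>g(e)\<close> of Waring's problem. It is a
  relation rather than a function because a function defined by \<open>LEAST\<close> has this meaning only
  by the Hilbert--Waring theorem, that is, that for each \<open>e \<ge> 1\<close> some number of powers suffices;
  by the same theorem such a \<open>g\<close> exists for every \<open>e \<ge> 1\<close>, and it is clearly unique.\<close>

definition is_waring_number :: "nat \<Rightarrow> nat \<Rightarrow> bool" where
  "is_waring_number e g \<longleftrightarrow>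
     sums_of_powers_suffice e g \<and> (\<forall>s. sums_of_powers_suffice e s \<longrightarrow> g \<le> s)"

definition least_exceeding_exponent :: "nat \<Rightarrow> nat \<Rightarrow> nat" where
  "least_exceeding_exponent b g = (LEAST p. b ^ p > g)"

end

theory Submission imports Defs begin

text \<open>
  Write \<open>S\<close> for the digit power sum, \<open>s = \<sigma>\<^sub>h(u)\<close>, \<open>k = \<sigma>\<^sub>h\<^sub>+\<^sub>1(u)\<close> and \<open>y = S(k)\<close>, so that
  \<open>y \<ge> s\<close>; suppose \<open>y > s\<close>. By Waring, every \<open>z\<close> is \<open>S(x)\<close> for some \<open>x\<close> with at most
  \<open>\<lfloor>z / (b-1)\<^sup>e\<rfloor> + g\<close> digits, while \<open>S(k) = y\<close> forces at least \<open>y / (b-1)\<^sup>e\<close> digits. Hence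
  \<open>y \<ge> s + b\<^sup>e\<^sup>+\<^sup>p \<ge> s + (g+1) (b-1)\<^sup>e\<close> would contradict the minimality of \<open>k\<close>.

  If \<open>y < s + b\<^sup>e\<^sup>+\<^sup>p\<close>, then no number below \<open>s\<close> has the same value of \<open>S\<close> as \<open>s\<close> or as \<open>y\<close>, so
  by the digit bound both have at most \<open>g / (1 - ((b-2)/(b-1))\<^sup>e)\<close> digits other than \<open>b-1\<close>, thus
  more than \<open>e + p + 1\<close> digits equal to \<open>b-1\<close>. Exchanging a high digit \<open>b-1\<close> with a low digit
  that is not \<open>b-1\<close> decreases the number without changing \<open>S\<close>, so the last \<open>e + p\<close> digits of
  both are all \<open>b-1\<close>, which makes \<open>y - s\<close> a positive multiple of \<open>b\<^sup>e\<^sup>+\<^sup>p\<close>.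
\<close>

section \<open>Digit power sums\<close>

context
  fixes e b :: nat
  assumes b: "b \<ge> 2" and e: "e \<ge> 1"
begin

text \<open>Padding with leading zeros is harmless because \<open>0 ^ e = 0\<close> for
  \<open>e \<ge> 1\<close>.\<close>

lemma digit_power_sum_eq_sum_lessThan:
  assumes "x < b ^ n"
  shows "digit_power_sum e b x = (\<Sum>i<n. (x div b ^ i mod b) ^ e)"
  unfolding digit_power_sum_def
proof (rule sum.mono_neutral_left)
  show "{i. b ^ i \<le> x} \<subseteq> {..<n}"
  proof
    fix i assume "i \<in> {i. b ^ i \<le> x}"
    then have "b ^ i < b ^ n" using assms by simp
    then show "i \<in> {..<n}" using b by simp
  qed
  show "\<forall>i\<in>{..<n} - {i. b ^ i \<le> x}. (x div b ^ i mod b) ^ e = 0"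
    using e by auto
qed simp

lemma digit_power_sum_0: "digit_power_sum e b 0 = 0"
  using digit_power_sum_eq_sum_lessThan[of 0 0] by simp

text \<open>Makes \<open>x\<close> itself a crude bound on its number of digits; applied to
  \<open>g\<close>, it also shows that the exponent \<open>p\<close> exists.\<close>

lemma less_base_power_self: "x < b ^ x"
  using b less_exp[of x] power_mono[of 2 b x] by (metis le0 order_less_le_trans)

lemma digit_power_sum_snoc:
  assumes "a < b"
  shows "digit_power_sum e b (b * x + a) = a ^ e + digit_power_sum e b x"
proof -
  have "b * x + a < b * b ^ x"
  proof -
    have "b * x + a < b * Suc x" using assms by simp
    also have "\<dots> \<le> b * b ^ x" using less_base_power_self[of x] by (intro mult_le_mono2) simp
    finally show ?thesis .
  qed
  then have "digit_power_sum e b (b * x + a)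
      = (\<Sum>i<Suc x. ((b * x + a) div b ^ i mod b) ^ e)"
    by (intro digit_power_sum_eq_sum_lessThan) simp
  also have "\<dots> = a ^ e + (\<Sum>i<x. ((b * x + a) div b ^ Suc i mod b) ^ e)"
    using assms by (subst sum.lessThan_Suc_shift) simp
  also have "(\<Sum>i<x. ((b * x + a) div b ^ Suc i mod b) ^ e) = (\<Sum>i<x. (x div b ^ i mod b) ^ e)"
    using assms b by (intro sum.cong refl) (simp add: div_mult2_eq)
  also have "\<dots> = digit_power_sum e b x"
    using less_base_power_self by (rule digit_power_sum_eq_sum_lessThan[symmetric])
  finally show ?thesis .
qed

lemma digit_power_sum_digit: "a < b \<Longrightarrow> digit_power_sum e b a = a ^ e"
  using digit_power_sum_snoc[of a 0] by (simp add: digit_power_sum_0)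

lemma digit_power_sum_times_base: "digit_power_sum e b (b * x) = digit_power_sum e b x"
  using digit_power_sum_snoc[of 0 x] b e by simp

lemma digit_power_sum_concat:
  assumes "y < b ^ m"
  shows "digit_power_sum e b (x * b ^ m + y) = digit_power_sum e b x + digit_power_sum e b y"
  using assms
proof (induction m arbitrary: y)
  case 0
  then show ?case by (simp add: digit_power_sum_0)
next
  case (Suc m)
  have a: "y mod b < b" using b by simp
  have *: "y div b < b ^ m" using Suc.prems b
    by (simp add: less_mult_imp_div_less mult.commute)
  have "x * b ^ Suc m + y = b * (x * b ^ m + y div b) + y mod b"
    using mult_div_mod_eq[of b y] by (simp add: algebra_simps)
  then have "digit_power_sum e b (x * b ^ Suc m + y)
      = (y mod b) ^ e + (digit_power_sum e b x + digit_power_sum e b (y div b))"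
    using digit_power_sum_snoc[OF a] Suc.IH[OF *] by metis
  moreover have "digit_power_sum e b y = (y mod b) ^ e + digit_power_sum e b (y div b)"
    using digit_power_sum_snoc[OF a, of "y div b"] by simp
  ultimately show ?case by simp
qed

lemma digit_power_sum_pos:
  assumes "x > 0"
  shows "digit_power_sum e b x > 0"
  using assms
proof (induction x rule: less_induct)
  case (less x)
  have eq: "digit_power_sum e b x = (x mod b) ^ e + digit_power_sum e b (x div b)"
    using digit_power_sum_snoc[of "x mod b" "x div b"] b by simp
  show ?case
  proof (cases "x mod b = 0")
    case True
    then have "x div b > 0" using less.prems by (metis add.right_neutral mult_0_right mult_div_mod_eq neq0_conv)
    moreover have "x div b < x" using less.prems b by simp
    ultimately show ?thesis using less.IH eq by simp
  qed (simp add: eq)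
qed

section \<open>Upper bounds from the number of digits\<close>

lemma digit_power_sum_le_of_digits:
  assumes "x < b ^ n"
  defines "k \<equiv> card {i. i < n \<and> x div b ^ i mod b = b - 1}"
  shows "digit_power_sum e b x \<le> k * (b - 1) ^ e + (n - k) * (b - 2) ^ e"
proof -
  define A where "A = {i. i < n \<and> x div b ^ i mod b = b - 1}"
  have A: "A \<subseteq> {..<n}" "finite A" by (auto simp: A_def)
  have "digit_power_sum e b x = (\<Sum>i<n. (x div b ^ i mod b) ^ e)"
    using assms(1) by (rule digit_power_sum_eq_sum_lessThan)
  also have "\<dots> = (\<Sum>i\<in>{..<n} - A. (x div b ^ i mod b) ^ e) + (\<Sum>i\<in>A. (x div b ^ i mod b) ^ e)"
    using A by (intro sum.subset_diff) auto
  also have "(\<Sum>i\<in>A. (x div b ^ i mod b) ^ e) = card A * (b - 1) ^ e"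
    by (simp add: A_def)
  also have "(\<Sum>i\<in>{..<n} - A. (x div b ^ i mod b) ^ e) \<le> (\<Sum>i\<in>{..<n} - A. (b - 2) ^ e)"
  proof (intro sum_mono power_mono)
    fix i assume i: "i \<in> {..<n} - A"
    have "x div b ^ i mod b < b" using b by simp
    moreover have "x div b ^ i mod b \<noteq> b - 1" using i by (auto simp: A_def)
    ultimately show "x div b ^ i mod b \<le> b - 2" by linarith
  qed simp
  also have "\<dots> = (n - card A) * (b - 2) ^ e"
    using A by (simp add: card_Diff_subset)
  finally show ?thesis by (simp add: k_def A_def)
qed

lemma digit_power_sum_le:
  assumes "x < b ^ n"
  shows "digit_power_sum e b x \<le> n * (b - 1) ^ e"
proof -
  have "digit_power_sum e b x = (\<Sum>i<n. (x div b ^ i mod b) ^ e)"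
    using assms by (rule digit_power_sum_eq_sum_lessThan)
  also have "\<dots> \<le> (\<Sum>i<n. (b - 1) ^ e)"
  proof (intro sum_mono power_mono)
    fix i
    have "x div b ^ i mod b < b" using b by simp
    then show "x div b ^ i mod b \<le> b - 1" by linarith
  qed simp
  finally show ?thesis by simp
qed

section \<open>Preimages with few digits, from Waring's problem\<close>

lemma ex_digit_power_sum_eq_sum:
  assumes "\<And>i. i < n \<Longrightarrow> a i < b"
  shows "\<exists>x < b ^ n. digit_power_sum e b x = (\<Sum>i<n. a i ^ e)"
  using assms
proof (induction n)
  case 0
  then show ?case by (simp add: digit_power_sum_0)
next
  case (Suc n)
  then obtain x where x: "x < b ^ n" "digit_power_sum e b x = (\<Sum>i<n. a i ^ e)"
    by auto
  have "b * x + a n < b * Suc x" using Suc.prems[of n] by simp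
  also have "\<dots> \<le> b * b ^ n" using x(1) by (intro mult_le_mono2) simp
  finally show ?case
    using x(2) digit_power_sum_snoc[of "a n" x] Suc.prems[of n]
    by (intro exI[of _ "b * x + a n"]) simp
qed

text \<open>The quotient of \<open>z\<close> by \<open>(b - 1) ^ e\<close> becomes that many digits
  \<open>b - 1\<close>. The remainder is a sum of \<open>g\<close> powers, each below
  \<open>(b - 1) ^ e\<close>, so their bases are legitimate digits.\<close>

lemma ex_digit_power_sum_eq:
  assumes "sums_of_powers_suffice e g"
  shows "\<exists>x < b ^ (z div (b - 1) ^ e + g). digit_power_sum e b x = z"
proof -
  define P where "P = (b - 1) ^ e"
  have P: "P > 0" using b by (simp add: P_def)
  obtain f :: "nat \<Rightarrow> nat" where f: "z mod P = (\<Sum>i<g. f i ^ e)"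
    using assms unfolding sums_of_powers_suffice_def by blast
  have fb: "f i < b" if "i < g" for i
  proof (rule ccontr)
    assume "\<not> f i < b"
    then have "P \<le> f i ^ e" unfolding P_def by (intro power_mono) auto
    also have "\<dots> \<le> z mod P" unfolding f using that by (intro member_le_sum) auto
    finally show False using mod_less_divisor[OF P, of z] by linarith
  qed
  obtain x where x: "x < b ^ g" "digit_power_sum e b x = z mod P"
    using ex_digit_power_sum_eq_sum[of g f] fb f by auto
  obtain x' where x': "x' < b ^ (z div P)" "digit_power_sum e b x' = (z div P) * P"
    using ex_digit_power_sum_eq_sum[of "z div P" "\<lambda>_. b - 1"] b by (auto simp: P_def)
  have "x' * b ^ g + x < Suc x' * b ^ g" using x(1) by simp
  also have "\<dots> \<le> b ^ (z div P) * b ^ g" using x'(1) by (intro mult_le_mono1) simp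
  finally have "x' * b ^ g + x < b ^ (z div P + g)" by (simp add: power_add)
  moreover have "digit_power_sum e b (x' * b ^ g + x) = z"
    using digit_power_sum_concat[OF x(1), of x'] x x' by simp
  ultimately show ?thesis by (auto simp: P_def)
qed

lemma ex_digits_bound:
  assumes "x > 0"
  obtains n where "b ^ n \<le> x" "x < b ^ Suc n"
  using ex_power_ivl1[of b x] b assms by auto

text \<open>Only the order of the digits changes, and the value drops by
  \<open>(b - 1 - a) * (b ^ j - b ^ i)\<close>, where \<open>a < b - 1\<close> is the digit at
  \<open>i\<close>.\<close>

lemma swap_digits:
  assumes "i < j" and j: "x div b ^ j mod b = b - 1" and i: "x div b ^ i mod b \<noteq> b - 1"
  shows "\<exists>x'. digit_power_sum e b x' = digit_power_sum e b x \<and> x' + b ^ j \<le> x + b ^ i"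
proof -
  \<comment> \<open>\<open>A\<close>, \<open>B\<close>, \<open>C\<close> will be the digit blocks
    above \<open>j\<close>, strictly between \<open>j\<close> and \<open>i\<close>, and below
    \<open>i\<close>; \<open>l\<close> is the length of \<open>B\<close>.\<close>
  define l where "l = j - Suc i"
  have jl: "j = Suc (l + i)" using assms(1) by (simp add: l_def)
  define a where "a = x div b ^ i mod b"
  define C where "C = x mod b ^ i"
  define B where "B = x div b ^ Suc i mod b ^ l"
  define A where "A = x div b ^ Suc j"
  have a: "a < b - 1"
    using i mod_less_divisor[of b "x div b ^ i"] b unfolding a_def by linarith
  have C: "C < b ^ i" and B: "B < b ^ l" using b by (simp_all add: C_def B_def)
  have step: "x div b ^ m = x div b ^ Suc m * b + x div b ^ m mod b" for m
    by (metis div_mult2_eq div_mult_mod_eq power_Suc2)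
  have "x = x div b ^ i * b ^ i + C" unfolding C_def by (rule div_mult_mod_eq[symmetric])
  also have "x div b ^ i = x div b ^ Suc i * b + a" using step[of i] by (simp add: a_def)
  also have "x div b ^ Suc i = x div b ^ j * b ^ l + B"
  proof -
    have "x div b ^ j = x div b ^ Suc i div b ^ l"
      by (simp add: jl div_mult2_eq[symmetric] power_add mult_ac)
    then show ?thesis unfolding B_def by (simp only: div_mult_mod_eq)
  qed
  also have "x div b ^ j = A * b + (b - 1)" using step[of j] j by (simp add: A_def)
  finally have x: "x = (((A * b + (b - 1)) * b ^ l + B) * b + a) * b ^ i + C" .
  define x' where "x' = (((A * b + a) * b ^ l + B) * b + (b - 1)) * b ^ i + C"
  have S: "digit_power_sum e b ((((A * b + v) * b ^ l + B) * b + w) * b ^ i + C)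
      = digit_power_sum e b A + v ^ e + digit_power_sum e b B + w ^ e + digit_power_sum e b C"
    if "v < b" "w < b" for v w
    using that digit_power_sum_snoc
    by (simp add: digit_power_sum_concat[OF C] digit_power_sum_concat[OF B] mult.commute[of _ b])
  have "digit_power_sum e b x' = digit_power_sum e b x"
    unfolding x x'_def using S[of a "b - 1"] S[of "b - 1" a] a b by simp
  moreover have "x' + b ^ j \<le> x + b ^ i"
  proof -
    obtain c where c: "b - 1 = a + Suc c" using a less_imp_Suc_add by fastforce
    have "b ^ i * 1 \<le> b ^ i * (b ^ l * b)" using b by (intro mult_le_mono2) simp
    then have "c * b ^ i \<le> c * (b ^ i * b ^ l * b)" by (intro mult_le_mono2) (simp add: mult_ac)
    then show ?thesis unfolding x x'_def c jl by (simp add: algebra_simps power_add)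
  qed
  ultimately show ?thesis by blast
qed

lemma mod_power_eq_of_digits:
  assumes "\<And>i. i < m \<Longrightarrow> x div b ^ i mod b = b - 1"
  shows "x mod b ^ m = b ^ m - 1"
  using assms
proof (induction m)
  case (Suc m)
  have "x mod b ^ Suc m = b ^ m * (x div b ^ m mod b) + x mod b ^ m"
    by (simp add: mod_mult2_eq power_Suc2 del: power_Suc)
  also have "\<dots> = b ^ m * (b - 1) + (b ^ m - 1)" using Suc by simp
  also have "\<dots> = b ^ Suc m - 1"
    using b by (cases b) (simp_all add: algebra_simps)
  finally show ?case .
qed simp

text \<open>Once \<open>u\<close> has more than \<open>t\<close> digits, \<open>growth\<close> sends
  every \<open>x \<le> u\<close> below \<open>u\<close>, so the orbit of \<open>u\<close> never
  returns to it.\<close>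

lemma periodic_less:
  assumes growth: "\<And>n. n > t \<Longrightarrow> n * (b - 1) ^ e < b ^ (n - 1)"
    and per: "(digit_power_sum e b ^^ m) u = u" and "m > 0"
  shows "u < b ^ t"
proof (rule ccontr)
  assume t: "\<not> u < b ^ t"
  then have "u > 0" using b by (metis zero_less_power gr0I less_le_trans pos2)
  then obtain n where n: "b ^ n \<le> u" "u < b ^ Suc n" by (rule ex_digits_bound)
  have "b ^ t < b ^ Suc n" using t n by simp
  then have "t < Suc n" using b by (simp del: power_Suc)
  then have growth': "Suc n * (b - 1) ^ e < b ^ n" using growth[of "Suc n"] by simp
  have less: "digit_power_sum e b x < u" if "x \<le> u" for x
    using digit_power_sum_le[of x "Suc n"] that n growth' by linarith
  have "(digit_power_sum e b ^^ Suc i) u < u" for i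
    by (induction i) (simp_all add: less)
  from this[of "m - 1"] show False using per \<open>m > 0\<close> by simp
qed

section \<open>Attracted numbers\<close>

lemma attracted_0_iff: "attracted e b 0 u x \<longleftrightarrow> x > 0 \<and> x = u"
  by (auto simp: attracted_def)

lemma attracted_Suc_iff:
  "attracted e b (Suc h) u x \<longleftrightarrow> x > 0 \<and> x \<noteq> u \<and> attracted e b h u (digit_power_sum e b x)"
  using digit_power_sum_pos[of x]
  by (auto simp: attracted_def funpow_Suc_right less_Suc_eq_0_disj simp del: funpow.simps(2))

lemma attracted_funpow: "attracted e b h u x \<Longrightarrow> (digit_power_sum e b ^^ h) x = u"
  by (simp add: attracted_def)

text \<open>A preimage \<open>x\<close> of \<open>z\<close> fails only if it is \<open>u\<close>;
  then \<open>b * x\<close> is a preimage of \<open>z\<close> different from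
  \<open>u\<close>.\<close>

lemma ex_attracted_Suc:
  assumes "sums_of_powers_suffice e g" "attracted e b h u z"
  shows "\<exists>x. attracted e b (Suc h) u x \<and> digit_power_sum e b x = z"
proof -
  obtain x where x: "digit_power_sum e b x = z"
    using ex_digit_power_sum_eq[OF assms(1)] by blast
  have "z > 0" using assms(2) by (simp add: attracted_def)
  then have "x > 0" using x by (metis digit_power_sum_0 gr0I)
  moreover from this have "b * x \<noteq> x" using b by simp
  ultimately show ?thesis
    using attracted_Suc_iff[of h u x] attracted_Suc_iff[of h u "b * x"] assms(2) x b
      digit_power_sum_times_base[of x]
    by (cases "x = u") force+
qed

lemma ex_attracted:
  assumes "sums_of_powers_suffice e g" "u > 0"
  shows "\<exists>x. attracted e b h u x"
proof (induction h)
  case 0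
  then show ?case using assms(2) by (simp add: attracted_0_iff)
next
  case (Suc h)
  then show ?case using ex_attracted_Suc[OF assms(1)] by blast
qed

lemma attracted_smallest_attracted:
  assumes "sums_of_powers_suffice e g" "u > 0"
  shows "attracted e b h u (smallest_attracted h e b u)"
  unfolding smallest_attracted_def using ex_attracted[OF assms] by (rule LeastI_ex)

lemma smallest_attracted_le: "attracted e b h u x \<Longrightarrow> smallest_attracted h e b u \<le> x"
  unfolding smallest_attracted_def by (rule Least_le)

text \<open>Multiplying by \<open>b\<close> circumvents the exclusion of \<open>u\<close> itself from the numbers of height
  \<open>h + 1\<close>.\<close>

lemma smallest_attracted_le_of_digit_power_sum_eq:
  assumes growth: "\<And>n. n > t \<Longrightarrow> n * (b - 1) ^ e < b ^ (n - 1)"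
    and large: "smallest_attracted (Suc h) e b u \<ge> b ^ Suc t"
    and y: "attracted e b (Suc h) u y" and x: "digit_power_sum e b x = digit_power_sum e b y"
  shows "smallest_attracted (Suc h) e b u \<le> x"
proof -
  have z: "attracted e b h u (digit_power_sum e b x)" using y x by (simp add: attracted_Suc_iff)
  then have x0: "x > 0" using digit_power_sum_0 by (metis attracted_def gr0I)
  show ?thesis
  proof (cases "x = u")
    case False
    then show ?thesis using z x0 by (intro smallest_attracted_le) (simp add: attracted_Suc_iff)
  next
    case True
    \<comment> \<open>This case is contradictory: \<open>u\<close> is periodic, hence below
      \<open>b ^ t\<close>, and the factor \<open>b\<close> costs one more digit, which is why
      \<open>large\<close> has \<open>Suc t\<close>.\<close>
    have "(digit_power_sum e b ^^ Suc h) u = u"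
      using attracted_funpow[OF z] True by (simp add: funpow_Suc_right del: funpow.simps(2))
    then have "x < b ^ t" using periodic_less[OF growth] True by blast
    then have small: "b * x < b ^ Suc t" using b by simp
    have "b * x \<noteq> u" "b * x > 0" using True x0 b by simp_all
    then have "attracted e b (Suc h) u (b * x)"
      using z digit_power_sum_times_base by (simp add: attracted_Suc_iff)
    then have "smallest_attracted (Suc h) e b u \<le> b * x" by (rule smallest_attracted_le)
    then show ?thesis using small large by simp
  qed
qed

end

section \<open>The threshold on the number of digits\<close>

text \<open>The number \<open>2 ^ e - 1\<close> can use only the powers 0 and 1, so it needs at
  least \<open>2 ^ e - 1 \<ge> e\<close> summands.\<close>

lemma exponent_le_waring:
  assumes "sums_of_powers_suffice e g" "e \<ge> 1"
  shows "e \<le> g"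
proof -
  obtain f :: "nat \<Rightarrow> nat" where f: "2 ^ e - 1 = (\<Sum>i<g. f i ^ e)"
    using assms unfolding sums_of_powers_suffice_def by blast
  have "f i ^ e \<le> 1" if "i < g" for i
  proof (rule ccontr)
    assume "\<not> f i ^ e \<le> 1"
    then have "f i \<ge> 2" using assms(2)
      by (metis One_nat_def less_2_cases_iff not_le order_refl power_one zero_le zero_power
          less_le_trans zero_less_one)
    then have "2 ^ e \<le> f i ^ e" by (intro power_mono) auto
    also have "\<dots> \<le> 2 ^ e - 1" unfolding f using that by (intro member_le_sum) auto
    finally show False using less_exp[of e] by linarith
  qed
  then have "(\<Sum>i<g. f i ^ e) \<le> (\<Sum>i<g. 1)" by (intro sum_mono) auto
  then have "2 ^ e - 1 \<le> g" using f by simp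
  then show ?thesis using less_exp[of e] by linarith
qed

text \<open>Split \<open>n - 1 = m + e\<close>: then \<open>b ^ m \<ge> 2 * m \<ge> n\<close> and
  \<open>b ^ e > (b - 1) ^ e\<close>.\<close>

lemma less_base_power_of_ge:
  fixes b e n :: nat
  assumes "b \<ge> 2" "e \<ge> 1" "n \<ge> 2 * e + 2"
  shows "n * (b - 1) ^ e < b ^ (n - 1)"
proof -
  define m where "m = n - 1 - e"
  have m: "n \<le> 2 * m" "n - 1 = m + e" "m \<ge> 1" using assms by (simp_all add: m_def)
  have "2 * m \<le> 2 ^ m" using m(3)
    by (induction m rule: dec_induct) auto
  also have "\<dots> \<le> b ^ m" using assms(1) by (intro power_mono) auto
  finally have "n \<le> b ^ m" using m(1) by simp
  moreover have "(b - 1) ^ e < b ^ e" using assms by (intro power_strict_mono) auto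
  moreover have "n > 0" using assms by simp
  ultimately have "n * (b - 1) ^ e < b ^ m * b ^ e"
    by (meson le_less_trans mult_le_mono1 mult_less_mono2 less_le_trans)
  then show ?thesis by (simp only: m power_add)
qed

context
  fixes e b g p d :: nat
  assumes b: "b \<ge> 2" and e: "e \<ge> 1"
    and g: "sums_of_powers_suffice e g"
    and p: "b ^ p > g"
    and d: "real d \<ge> (real g + 1) / (1 - ((real b - 2) / (real b - 1)) ^ e) + real e + real p"
begin

lemma digit_ratio_power:
  "((real b - 2) / (real b - 1)) ^ e = real ((b - 2) ^ e) / real ((b - 1) ^ e)"
  "(b - 2) ^ e < (b - 1) ^ e"
  using b e by (auto simp: power_divide intro: power_strict_mono)

lemma Suc_waring_add_le_threshold: "g + 1 + e + p \<le> d"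
proof -
  define \<delta> where "\<delta> = 1 - real ((b - 2) ^ e) / real ((b - 1) ^ e)"
  have "\<delta> > 0" "\<delta> \<le> 1" using digit_ratio_power(2) b by (simp_all add: \<delta>_def flip: of_nat_power)
  then have "real g + 1 \<le> (real g + 1) / \<delta>" using mult_left_le[of \<delta> "real g + 1"] by (simp add: le_divide_eq mult.commute)
  then have "real (g + 1 + e + p) \<le> real d" using d by (simp add: digit_ratio_power \<delta>_def)
  then show ?thesis by linarith
qed

text \<open>This is \<open>growth\<close> for \<open>t = d - 1\<close>, so that
  \<open>Suc t = d\<close>. Since \<open>p > 0\<close> and \<open>g \<ge> e\<close>, the threshold
  satisfies \<open>d \<ge> 2 * e + 2\<close>.\<close>

lemma digit_power_sum_growth:
  assumes "n > d - 1"
  shows "n * (b - 1) ^ e < b ^ (n - 1)"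
proof -
  have "p \<noteq> 0" using p exponent_le_waring[OF g e] e by (intro notI) simp
  then show ?thesis using assms Suc_waring_add_le_threshold exponent_le_waring[OF g e]
    by (intro less_base_power_of_ge b e) linarith
qed

text \<open>With \<open>k\<close> digits \<open>b - 1\<close>, comparing the two bounds on the digit
  power sum gives \<open>(n - k) * (P - Q) \<le> g * P\<close>, that is,
  \<open>n - k \<le> g / \<delta>\<close>. The term \<open>1 / \<delta> \<ge> 1\<close> in
  \<open>d\<close> and the strict \<open>n > d\<close> supply the final 2.\<close>

lemma card_max_digits_ge:
  assumes x: "x < b ^ n" and n: "n > d"
    and "n \<le> digit_power_sum e b x div (b - 1) ^ e + g"
  shows "card {i. i < n \<and> x div b ^ i mod b = b - 1} \<ge> e + p + 2"
proof -
  define k where "k = card {i. i < n \<and> x div b ^ i mod b = b - 1}"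
  define P where "P = (b - 1) ^ e"
  define Q where "Q = (b - 2) ^ e"
  define \<delta> where "\<delta> = 1 - real Q / real P"
  have QP: "Q < P" unfolding P_def Q_def by (rule digit_ratio_power)
  then have \<delta>: "\<delta> > 0" "\<delta> \<le> 1" by (simp_all add: \<delta>_def)
  have "k \<le> card {..<n}" unfolding k_def by (intro card_mono) auto
  then have kn: "k \<le> n" by simp
  have "n * P \<le> (digit_power_sum e b x div P + g) * P"
    using assms(3) by (intro mult_le_mono1) (simp add: P_def)
  also have "\<dots> \<le> digit_power_sum e b x + g * P" by (simp add: algebra_simps)
  also have "\<dots> \<le> k * P + (n - k) * Q + g * P"
    using digit_power_sum_le_of_digits[OF b e x] by (simp add: k_def P_def Q_def)
  finally have "real (n * P) \<le> real (k * P + (n - k) * Q + g * P)" by (rule of_nat_mono)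
  then have "real n * real P \<le> real k * real P + (real n - real k) * real Q + real g * real P"
    using kn by (simp only: of_nat_add of_nat_mult of_nat_diff)
  then have "(real n - real k) * (real P - real Q) \<le> real g * real P"
    by (simp add: algebra_simps)
  moreover have "real P - real Q = \<delta> * real P" using QP by (simp add: \<delta>_def field_simps)
  ultimately have "((real n - real k) * \<delta>) * real P \<le> real g * real P"
    by (simp add: mult.assoc)
  then have "(real n - real k) * \<delta> \<le> real g" using QP by simp
  then have "real n - real k \<le> real g / \<delta>" using \<delta> by (simp add: field_simps)
  moreover have "real d \<ge> real g / \<delta> + 1 / \<delta> + real e + real p"
    using d by (simp add: digit_ratio_power \<delta>_def P_def Q_def add_divide_distrib)
  moreover have "1 / \<delta> \<ge> 1" using \<delta> by simp
  moreover have "real n \<ge> real d + 1" using n by simp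
  ultimately have "real (e + p + 2) \<le> real k" by simp
  then show ?thesis by (simp only: of_nat_le_iff k_def)
qed

text \<open>Pigeonhole: there are only \<open>e + p\<close> positions up to \<open>e + p\<close>
  other than \<open>i\<close>.\<close>

lemma ex_high_max_digit:
  assumes card: "card {i. i < n \<and> x div b ^ i mod b = b - 1} \<ge> e + p + 2"
    and i: "i < e + p" "x div b ^ i mod b \<noteq> b - 1"
  shows "\<exists>j > e + p. x div b ^ j mod b = b - 1"
proof (rule ccontr)
  assume "\<not> ?thesis"
  then have "{i. i < n \<and> x div b ^ i mod b = b - 1} \<subseteq> {..e + p} - {i}"
    using i by (auto simp: not_less)
  then have "card {i. i < n \<and> x div b ^ i mod b = b - 1} \<le> card ({..e + p} - {i})"
    by (intro card_mono) auto
  also have "\<dots> \<le> e + p" using i by simp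
  finally show False using card by simp
qed

text \<open>In the application \<open>y\<close> has the same height as \<open>s\<close>, so numbers
  sharing its digit power sum are also at least \<open>s\<close>; this lets \<open>y\<close>, itself
  not minimal, be treated like \<open>s\<close>.\<close>

lemma gap_ge:
  assumes s: "s \<ge> b ^ d" "s < y"
    and min_s: "\<And>x. digit_power_sum e b x = digit_power_sum e b s \<Longrightarrow> s \<le> x"
    and min_y: "\<And>x. digit_power_sum e b x = digit_power_sum e b y \<Longrightarrow> s \<le> x"
  shows "s + b ^ (e + p) \<le> y"
proof (rule ccontr)
  assume "\<not> ?thesis"
  then have gap: "y < s + b ^ (e + p)" by simp
  have "s > 0" using s(1) b by (metis gr0I le_zero_eq power_not_zero not_numeral_le_zero)
  then obtain n' where n': "b ^ n' \<le> s" "s < b ^ Suc n'" by (rule ex_digits_bound[OF b e])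
  define n where "n = Suc n'"
  have sn: "s < b ^ n" using n' by (simp add: n_def)
  have "b ^ d < b ^ n" using s(1) sn by simp
  then have dn: "d < n" using b by simp
  \<comment> \<open>The short Waring preimage is at least \<open>s\<close>, hence has at least
    \<open>n\<close> digits.\<close>
  have len: "n \<le> digit_power_sum e b w div (b - 1) ^ e + g"
    if "\<And>x. digit_power_sum e b x = digit_power_sum e b w \<Longrightarrow> s \<le> x" for w
  proof -
    obtain x where "x < b ^ (digit_power_sum e b w div (b - 1) ^ e + g)"
      "digit_power_sum e b x = digit_power_sum e b w"
      using ex_digit_power_sum_eq[OF b e g] by blast
    then have "b ^ n' < b ^ (digit_power_sum e b w div (b - 1) ^ e + g)"
      using that[of x] n' by linarith
    then show ?thesis using b by (simp add: n_def)
  qed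
  \<comment> \<open>Otherwise \<open>y\<close> is a digit 1 followed by zeros and at most
    \<open>e + p\<close> low digits, and its digit power sum is too small for
    \<open>len\<close>.\<close>
  have yn: "y < b ^ n"
  proof (rule ccontr)
    assume "\<not> y < b ^ n"
    then obtain w where y: "y = b ^ n + w" using le_Suc_ex not_less by blast
    have w: "w < b ^ (e + p)" using gap sn y by simp
    also have "\<dots> \<le> b ^ n" using dn Suc_waring_add_le_threshold b by (intro power_increasing) auto
    finally have "digit_power_sum e b y = digit_power_sum e b 1 + digit_power_sum e b w"
      using digit_power_sum_concat[OF b e, of w n 1] y by simp
    also have "\<dots> \<le> 1 + (e + p) * (b - 1) ^ e"
      using digit_power_sum_le[OF b e w] digit_power_sum_digit[OF b e, of 1] b by simp
    also have "\<dots> \<le> (e + p + 1) * (b - 1) ^ e" using b by simp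
    finally have "digit_power_sum e b y div (b - 1) ^ e \<le> e + p + 1"
      using b by (metis div_le_mono nonzero_mult_div_cancel_right power_not_zero
          diff_is_0_eq not_less_eq_eq numeral_2_eq_2 One_nat_def)
    then show False using len[of y, OF min_y] dn Suc_waring_add_le_threshold by linarith
  qed
  note cards = card_max_digits_ge[OF sn dn len[of s, OF min_s]] card_max_digits_ge[OF yn dn len[of y, OF min_y]]
  text \<open>Exchanging digits at positions \<open>i < e + p < j\<close> lowers a number by more than \<open>b\<^sup>e\<^sup>+\<^sup>p\<close>,
    hence brings even \<open>y\<close> below \<open>s\<close>.\<close>
  have low: "w mod b ^ (e + p) = b ^ (e + p) - 1"
    if card: "card {i. i < n \<and> w div b ^ i mod b = b - 1} \<ge> e + p + 2"
      and w: "w < s + b ^ (e + p)"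
      and min_w: "\<And>x. digit_power_sum e b x = digit_power_sum e b w \<Longrightarrow> s \<le> x" for w
  proof (rule mod_power_eq_of_digits[OF b e], rule ccontr)
    fix i assume i: "i < e + p" "w div b ^ i mod b \<noteq> b - 1"
    obtain j where j: "j > e + p" "w div b ^ j mod b = b - 1"
      using ex_high_max_digit[OF card i] by blast
    obtain x where x: "digit_power_sum e b x = digit_power_sum e b w" "x + b ^ j \<le> w + b ^ i"
      using swap_digits[OF b e, of i j w] i j by auto
    have "2 * b ^ (e + p) \<le> b * b ^ (e + p)" using b by (intro mult_le_mono1)
    also have "\<dots> \<le> b ^ j" using j b power_increasing[of "Suc (e + p)" j b] by simp
    finally have "2 * b ^ (e + p) \<le> b ^ j" .
    moreover have "b ^ i < b ^ (e + p)" using i b by simp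
    ultimately show False using x(2) w min_w[OF x(1)] by linarith
  qed
  have "s mod b ^ (e + p) = y mod b ^ (e + p)"
    using low[OF cards(1) _ min_s] low[OF cards(2) gap min_y] b by simp
  then have "b ^ (e + p) dvd y - s" using s(2) mod_eq_dvd_iff_nat[of s y] by (metis less_imp_le)
  then have "b ^ (e + p) \<le> y - s" using s(2) by (intro dvd_imp_le) auto
  then show False using gap s(2) by simp
qed

lemma digit_power_sum_smallest_attracted:
  assumes u: "u > 0" and large: "smallest_attracted h e b u \<ge> b ^ d"
  shows "digit_power_sum e b (smallest_attracted (Suc h) e b u) = smallest_attracted h e b u"
proof -
  define s where "s = smallest_attracted h e b u"
  define k where "k = smallest_attracted (Suc h) e b u"
  define y where "y = digit_power_sum e b k"
  have att_s: "attracted e b h u s" and att_k: "attracted e b (Suc h) u k"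
    unfolding s_def k_def using attracted_smallest_attracted[OF b e g u] by blast+
  have att_y: "attracted e b h u y" using att_k by (simp add: y_def attracted_Suc_iff[OF b e])
  then have "s \<le> y" unfolding s_def by (rule smallest_attracted_le[OF b e])
  moreover have "\<not> s < y"
  proof
    assume less: "s < y"
    \<comment> \<open>At height 0 only \<open>u\<close> is attracted, which would force
      \<open>s = y\<close>.\<close>
    then have "h \<noteq> 0" using att_s att_y by (metis attracted_0_iff[OF b e] less_irrefl)
    then obtain h' where h: "h = Suc h'" using not0_implies_Suc by blast
    have Suc_d: "Suc (d - 1) = d" using Suc_waring_add_le_threshold by simp
    have min: "s \<le> x"
      if "attracted e b h u w" "digit_power_sum e b x = digit_power_sum e b w" for w x
      using smallest_attracted_le_of_digit_power_sum_eq[OF b e, of "d - 1" h' u w x, unfolded Suc_d]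
        digit_power_sum_growth that large by (simp add: s_def h)
    have "s + b ^ (e + p) \<le> y"
      using gap_ge[OF large[folded s_def] less] min[OF att_s] min[OF att_y] by blast
    moreover have "(g + 1) * (b - 1) ^ e \<le> b ^ (e + p)"
    proof -
      have "(b - 1) ^ e \<le> b ^ e" by (intro power_mono) auto
      then have "(g + 1) * (b - 1) ^ e \<le> b ^ p * b ^ e" using p by (intro mult_le_mono) auto
      then show ?thesis by (simp add: power_add mult.commute)
    qed
    ultimately have gap: "s + (g + 1) * (b - 1) ^ e \<le> y" by simp
    obtain k' where k': "k' < b ^ (s div (b - 1) ^ e + g)" "digit_power_sum e b k' = s"
      using ex_digit_power_sum_eq[OF b e g] by blast
    \<comment> \<open>If \<open>k' = u\<close>, the orbit of \<open>s\<close> reaches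
      \<open>u\<close> and then returns to \<open>s\<close>, but \<open>s\<close> is too large to be
      periodic.\<close>
    have "k' \<noteq> u"
    proof
      assume "k' = u"
      then have "(digit_power_sum e b ^^ Suc h) s = s"
        using attracted_funpow[OF b e att_s] k' by simp
      then have "s < b ^ (d - 1)" using periodic_less[OF b e digit_power_sum_growth] by blast
      moreover have "b ^ (d - 1) \<le> b ^ d" using b by (intro power_increasing) auto
      ultimately show False using large by (simp add: s_def)
    qed
    moreover have "k' > 0"
      using k' att_s digit_power_sum_0[OF b e] by (metis attracted_def gr0I)
    ultimately have "attracted e b (Suc h) u k'"
      using k' att_s by (simp add: attracted_Suc_iff[OF b e])
    then have "k \<le> k'" unfolding k_def by (rule smallest_attracted_le[OF b e])
    \<comment> \<open>Being at most \<open>k'\<close>, the number \<open>k\<close> inherits its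
      bound on the number of digits, which keeps \<open>y\<close> within
      \<open>g * (b - 1) ^ e\<close> of \<open>s\<close>.\<close>
    then have "y \<le> (s div (b - 1) ^ e + g) * (b - 1) ^ e"
      unfolding y_def using k'(1) by (intro digit_power_sum_le[OF b e]) simp
    also have "\<dots> \<le> s + g * (b - 1) ^ e" by (simp add: algebra_simps)
    also have "\<dots> < s + (g + 1) * (b - 1) ^ e" using b by simp
    finally show False using gap by simp
  qed
  ultimately show ?thesis by (simp add: s_def k_def y_def)
qed

end

theorem corollary3p4:
  fixes b e g p d h u :: nat
  assumes "b \<ge> 2" and "e \<ge> 1"
    and "is_waring_number e g"
    and "p = least_exceeding_exponent b g"
    and "d = nat \<lceil>(real g + 1) / (1 - ((real b - 2) / (real b - 1)) ^ e) + real e + real p\<rceil>"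
    and "u \<ge> 1"
    and "smallest_attracted h e b u \<ge> b ^ d"
  shows "digit_power_sum e b (smallest_attracted (h + 1) e b u) = smallest_attracted h e b u"
proof -
  have "sums_of_powers_suffice e g" using assms(3) by (simp add: is_waring_number_def)
  moreover have "b ^ p > g"
    unfolding assms(4) least_exceeding_exponent_def
    using less_base_power_self[OF assms(1,2)] by (rule LeastI)
  moreover have "real d \<ge> (real g + 1) / (1 - ((real b - 2) / (real b - 1)) ^ e) + real e + real p"
    unfolding assms(5) by (rule real_nat_ceiling_ge)
  ultimately show ?thesis
    using digit_power_sum_smallest_attracted[OF assms(1,2)] assms(6,7) by simp
qed

end
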